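(* Consider the following two Runge-Kutta schemes. (i) (Ramos--Vigo) $$A=\begin{bmatrix}\frac{22-\sqrt2}{96}&\frac{5-8\sqrt2}{48}&\frac{22-7\sqrt2}{96}&-\frac1{16}\\ \frac{4+3\sqrt2}{24}&\frac16&\frac{4-3\sqrt2}{24}&0\\ \frac{22+7\sqrt2}{96}&\frac{5+8\sqrt2}{48}&\frac{22+\sqrt2}{96}&-\frac1{16}\\ \frac13&\frac13&\frac13&0\end{bmatrix},\qquad b=\begin{bmatrix}\frac13&\frac13&\frac13&0\end{bmatrix}^T,$$ with $\beta^*=\dfrac{19699132}{4466212691}$. (ii) (Skvortsov) $A\in\mathbb{Q}^{9\times9}$ is the lower triangular matrix whose rows (listing the entries up to and including the diagonal, all further entries being $0$) are row 1: $0$; row 2: $\frac16,\ \frac16$; row 3: $\frac{11}{96},\ -\frac1{32},\ \frac16$; row 4: $\frac1{12},\ -\frac14,\ \frac12,\ \frac16$; row 5: $-\frac{2015}{15072},\ -\frac{6987}{5024},\ \frac{3271}{1884},\ \frac{175}{471},\ \frac16$; row 6: $-\frac{326531}{573678},\ -\frac{114988}{31871},\ \frac{1208156}{286839},\ \frac{132950}{286839},\ \frac{68}{203},\ \frac16$; row 7: $-\frac{331717945}{2106545616},\ -\frac{480525599}{416107776},\ \frac{2240951089}{1404363744},\ \frac{394951619}{2808727488},\ -\frac{5160553}{26834976},\ \frac{35815}{352512},\ \frac16$; row 8: $\frac{16264655341}{73026914688},\ \frac{9786099235}{14425069568},\ -\frac{34306812733}{48684609792},\ -\frac{15985588007}{97369219584},\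 \frac{37652437}{930279168},\ -\frac{340747}{12220416},\ \frac1{26},\ \frac16$; row 9: $\frac7{90},\ 0,\ 0,\ 0,\ \frac{16}{45},\ -\frac4{45},\ \frac2{15},\ \frac{16}{45},\ \frac16$; and $b^T$ is the last row of $A$, with $\beta^*=\dfrac{2218472195}{100000000000}$. Then each of the two schemes is $A(\alpha)$-stable for some maximum angle $\alpha$, and this maximum angle satisfies $\alpha\ge\alpha^*$, where $\alpha^*=\cos^{-1}\beta^*$ with the corresponding value of $\beta^*$.
   Context: For a Runge-Kutta scheme with coefficients $A\in\mathbb{R}^{s\times s}$, $b\in\mathbb{R}^s$, and with $e=[1,\ldots,1]^T\in\mathbb{R}^s$, the stability function is the rational function (in reduced form) $$W(z)=1+z\,b^T(I-zA)^{-1}e=\frac{\det(I-zA+zeb^T)}{\det(I-zA)}.$$ For $0<\alpha\le\frac\pi2$ let $S_\alpha=\{z\in\mathbb{C}:|\arg(-z)|\le\alpha\}$ (with the vertex $0$ included). The scheme is $A(\alpha)$-stable if $|W(z)|\le1$ for all $z\in S_\alpha$. The maximum angle of a scheme is the largest $\alpha\in(0,\frac\pi2]$ for which it is $A(\alpha)$-stable. *)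

theory Defs
  imports
    "Jordan_Normal_Form.Determinant"
    "HOL-Computational_Algebra.Field_as_Ring"
    "HOL-Computational_Algebra.Polynomial_Factorial"
begin

definition const_mat :: "real mat \<Rightarrow> complex poly mat" where
  "const_mat M = map_mat (\<lambda>a. [:complex_of_real a:]) M"

text \<open>
  The stability function of the scheme \<open>(A, b)\<close>, as an element of the field of rational functions
  over the complex numbers:
  \<open>W(z) = det(I - z A + z e b\<^sup>T) / det(I - z A)\<close> with \<open>e = (1, \<dots>, 1)\<^sup>T\<close>.
  The indeterminate \<open>z\<close> is the polynomial \<open>[:0, 1:]\<close>; the denominator has the value 1 at 0,
  so it is not the zero polynomial.
\<close>

definition stability_function :: "real mat \<Rightarrow> real vec \<Rightarrow> complex poly fract" where
  "stability_function A b =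
     (let s = dim_row A;
          z = [:0, 1:];
          e = vec s (\<lambda>_. 1 :: real);
          ebT = mat s s (\<lambda>(i, j). e $ i * b $ j)
      in Fract (det (1\<^sub>m s - z \<cdot>\<^sub>m const_mat A + z \<cdot>\<^sub>m const_mat ebT))
               (det (1\<^sub>m s - z \<cdot>\<^sub>m const_mat A)))"

text \<open>
  \<open>|W(z)| \<le> 1\<close> for a rational function \<open>W\<close>, evaluated in reduced form: \<open>quot_of_fract\<close> yields
  the coprime numerator and denominator. At a pole the inequality is false, which has to be said
  explicitly because division by zero yields zero.
\<close>

definition norm_le_one_at :: "complex poly fract \<Rightarrow> complex \<Rightarrow> bool" where
  "norm_le_one_at W z \<longleftrightarrow>
     (let (p, q) = quot_of_fract W in poly q z \<noteq> 0 \<and> norm (poly p z / poly q z) \<le> 1)"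

definition sector :: "real \<Rightarrow> complex set" where
  "sector \<alpha> = {z. z = 0 \<or> \<bar>Arg (- z)\<bar> \<le> \<alpha>}"

definition A_alpha_stable :: "real mat \<Rightarrow> real vec \<Rightarrow> real \<Rightarrow> bool" where
  "A_alpha_stable A b \<alpha> \<longleftrightarrow> (\<forall>z\<in>sector \<alpha>. norm_le_one_at (stability_function A b) z)"

definition is_maximum_angle :: "real mat \<Rightarrow> real vec \<Rightarrow> real \<Rightarrow> bool" where
  "is_maximum_angle A b \<alpha> \<longleftrightarrow>
     \<alpha> \<in> {0<..pi/2} \<and> A_alpha_stable A b \<alpha> \<and>
     (\<forall>\<alpha>'\<in>{0<..pi/2}. A_alpha_stable A b \<alpha>' \<longrightarrow> \<alpha>' \<le> \<alpha>)"

definition ramos_vigo_A :: "real mat" where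
  "ramos_vigo_A = mat_of_rows_list 4
    [[(22 - sqrt 2) / 96, (5 - 8 * sqrt 2) / 48, (22 - 7 * sqrt 2) / 96, - 1 / 16],
     [(4 + 3 * sqrt 2) / 24, 1 / 6, (4 - 3 * sqrt 2) / 24, 0],
     [(22 + 7 * sqrt 2) / 96, (5 + 8 * sqrt 2) / 48, (22 + sqrt 2) / 96, - 1 / 16],
     [1 / 3, 1 / 3, 1 / 3, 0]]"

definition ramos_vigo_b :: "real vec" where
  "ramos_vigo_b = vec_of_list [1 / 3, 1 / 3, 1 / 3, 0]"

definition skvortsov_A :: "real mat" where
  "skvortsov_A = mat_of_rows_list 9
    [[0, 0, 0, 0, 0, 0, 0, 0, 0],
     [1 / 6, 1 / 6, 0, 0, 0, 0, 0, 0, 0],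
     [11 / 96, - 1 / 32, 1 / 6, 0, 0, 0, 0, 0, 0],
     [1 / 12, - 1 / 4, 1 / 2, 1 / 6, 0, 0, 0, 0, 0],
     [- 2015 / 15072, - 6987 / 5024, 3271 / 1884, 175 / 471, 1 / 6, 0, 0, 0, 0],
     [- 326531 / 573678, - 114988 / 31871, 1208156 / 286839, 132950 / 286839, 68 / 203, 1 / 6,
      0, 0, 0],
     [- 331717945 / 2106545616, - 480525599 / 416107776, 2240951089 / 1404363744,
      394951619 / 2808727488, - 5160553 / 26834976, 35815 / 352512, 1 / 6, 0, 0],
     [16264655341 / 73026914688, 9786099235 / 14425069568, - 34306812733 / 48684609792,
      - 15985588007 / 97369219584, 37652437 / 930279168, - 340747 / 12220416, 1 / 26, 1 / 6, 0],
     [7 / 90, 0, 0, 0, 16 / 45, - 4 / 45, 2 / 15, 16 / 45, 1 / 6]]"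

definition skvortsov_b :: "real vec" where
  "skvortsov_b = row skvortsov_A 8"

end

theory Submission
  imports Defs "Jordan_Normal_Form.Char_Poly"
begin

text \<open>
  In both schemes the vector \<open>b\<^sup>T\<close> is the last row of \<open>A\<close>. Hence \<open>W\<close> is the last component
  of the vector \<open>y = (I - z A)\<^bsup>-1\<^esup> e\<close> of stage values of the test equation, and it is enough to
  exhibit polynomials \<open>w\<^sub>1, \<dots>, w\<^sub>s, q\<close> with \<open>(I - z A) w = q e\<close>: then \<open>W = w\<^sub>s / q\<close>
  (\<open>stability_function_stiffly_accurate\<close>), and no determinant is ever expanded. The result is
  \<open>W(z) = (384 + 144 z + 20 z\<^sup>2 + z\<^sup>3) / (384 - 240 z + 68 z\<^sup>2 - 11 z\<^sup>3 + z\<^sup>4)\<close> for Ramos--Vigo,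
  and for Skvortsov a polynomial of degree 7 divided by \<open>(6 - z)\<^sup>8\<close>.

  Write \<open>W = p / q\<close> and \<open>z = - x + i y\<close> with \<open>\<bar>z\<bar> = r\<close> and \<open>x = c r\<close>, so that \<open>c\<close> is the
  cosine of the angle between \<open>z\<close> and the negative real axis. Since \<open>p\<close> and \<open>q\<close> are real,
  \<open>\<bar>q(z)\<bar>\<^sup>2 - \<bar>p(z)\<bar>\<^sup>2\<close> is a polynomial in \<open>c\<close> and \<open>r\<close>, say \<open>\<Sum>\<^sub>k c\<^sup>k E\<^sub>k(r)\<close>. For both schemes
  it turns out that \<open>E\<^sub>k\<close> has nonnegative coefficients for every \<open>k \<ge> 1\<close>; only \<open>E\<^sub>0\<close>, the
  contribution of the imaginary axis, takes negative values. So the expression increases with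
  \<open>c\<close>, and on the whole sector \<open>c \<ge> \<beta>\<^sup>*\<close> it is bounded below by its value on the boundary rays
  \<open>c = \<beta>\<^sup>*\<close>, a polynomial in \<open>r\<close> alone. The number \<open>\<beta>\<^sup>*\<close> is a slight upward rounding of the
  value for which this polynomial acquires a positive double root, so it just stays positive for
  \<open>r > 0\<close>. Positivity is certified by writing it as \<open>r (r - m)\<^sup>2 Q(r)\<close> plus a small remainder,
  where \<open>m\<close> is close to the near-double root and \<open>Q\<close> and the remainder have nonnegative
  coefficients (\<open>A_alpha_stable_of_certificate\<close>).

  A maximum angle exists as soon as the scheme is stable for one angle: in reduced form, the
  inequality \<open>\<bar>W(z)\<bar> \<le> 1\<close> says \<open>\<bar>p(z)\<bar> \<le> \<bar>q(z)\<bar>\<close>, also at poles, and this is a closed condition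
  on \<open>z\<close>; so the supremum of the stable angles is itself stable (\<open>maximum_angle_exists\<close>).
\<close>

section \<open>The stability function from stage polynomials\<close>

text \<open>
  A denominator-free form of the matrix determinant lemma
  \<open>det (M + u v\<^sup>T) = (1 + v\<^sup>T M\<^bsup>-1\<^esup> u) det M\<close>, in which the solution \<open>w\<close> of \<open>M w = d u\<close> replaces
  the inverse. The bordered matrix with blocks \<open>1, - v\<^sup>T, u, M\<close> has determinant
  \<open>det (M + u v\<^sup>T)\<close> by clearing \<open>u\<close> with row operations. Clearing \<open>u\<close> with column operations
  instead, after scaling the first column by \<open>d\<close>, gives \<open>(d + v\<^sup>T w) det M\<close>.
\<close>

lemma det_rank_one_update_of_solution:
  fixes M :: "'a :: idom mat"
  assumes M: "M \<in> carrier_mat n n"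
    and u: "u \<in> carrier_vec n" and v: "v \<in> carrier_vec n" and w: "w \<in> carrier_vec n"
    and sol: "M *\<^sub>v w = d \<cdot>\<^sub>v u"
  shows "d * det (M + mat n n (\<lambda>(i, j). u $ i * v $ j)) = (d + v \<bullet> w) * det M"
proof -
  define U where "U = mat_of_cols n [u]"
  define V where "V = mat_of_rows n [v]"
  define W where "W = mat_of_cols n [w]"
  have U: "U \<in> carrier_mat n 1" and V: "V \<in> carrier_mat 1 n" and W: "W \<in> carrier_mat n 1"
    unfolding U_def V_def W_def carrier_mat_def by simp_all
  have UV: "U * V = mat n n (\<lambda>(i, j). u $ i * v $ j)"
    using u v by (intro eq_matI) (auto simp: U_def V_def scalar_prod_def mat_of_cols_def mat_of_rows_def)
  have VW: "V * W = (v \<bullet> w) \<cdot>\<^sub>m 1\<^sub>m 1"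
    using v w by (intro eq_matI) (auto simp: V_def W_def)
  have MW: "M * W = d \<cdot>\<^sub>m U"
  proof (rule eq_matI)
    fix i j assume "i < dim_row (d \<cdot>\<^sub>m U)" "j < dim_col (d \<cdot>\<^sub>m U)"
    then have ij: "i < n" "j = 0" using U by auto
    have "(M * W) $$ (i, j) = (M *\<^sub>v w) $ i"
      using ij M W w by (simp add: W_def)
    then show "(M * W) $$ (i, j) = (d \<cdot>\<^sub>m U) $$ (i, j)"
      using ij u by (simp add: sol U_def mat_of_cols_def)
  qed (use M U W in auto)
  define B where "B = four_block_mat (1\<^sub>m 1) (- V) U M"
  have "four_block_mat (1\<^sub>m 1) (0\<^sub>m 1 n) (- U) (1\<^sub>m n) * B
      = four_block_mat (1\<^sub>m 1) (- V) (0\<^sub>m n 1) (M + U * V)"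
    unfolding B_def
    by (subst mult_four_block_mat[where ?n1.0 = 1 and ?n2.0 = n and ?nc1.0 = 1 and ?nc2.0 = n])
       (use M U V in \<open>auto intro!: cong_four_block_mat eq_matI simp: add.commute\<close>)
  then have "det (four_block_mat (1\<^sub>m 1) (0\<^sub>m 1 n) (- U) (1\<^sub>m n)) * det B = det (M + U * V)"
    using M U V by (subst det_mult[symmetric, where n = "1 + n"])
      (auto simp: B_def det_four_block_mat_lower_left_zero[where n = 1 and m = n])
  then have B1: "det B = det (M + U * V)"
    using U by (simp add: det_four_block_mat_upper_right_zero[where n = 1 and m = n])
  have "B * four_block_mat (d \<cdot>\<^sub>m 1\<^sub>m 1) (0\<^sub>m 1 n) (- W) (1\<^sub>m n)
      = four_block_mat ((d + v \<bullet> w) \<cdot>\<^sub>m 1\<^sub>m 1) (- V) (0\<^sub>m n 1) M"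
    unfolding B_def
    by (subst mult_four_block_mat[where ?n1.0 = 1 and ?n2.0 = n and ?nc1.0 = 1 and ?nc2.0 = n])
       (use M U V W VW MW in \<open>auto intro!: cong_four_block_mat eq_matI simp: algebra_simps\<close>)
  then have "det B * det (four_block_mat (d \<cdot>\<^sub>m 1\<^sub>m 1) (0\<^sub>m 1 n) (- W) (1\<^sub>m n))
      = (d + v \<bullet> w) * det M"
    using M U V W by (subst det_mult[symmetric, where n = "1 + n"])
      (auto simp: B_def det_four_block_mat_lower_left_zero[where n = 1 and m = n] det_single)
  then have "det B * d = (d + v \<bullet> w) * det M"
    using W by (simp add: det_four_block_mat_upper_right_zero[where n = 1 and m = n] det_single)
  then show ?thesis
    by (simp add: B1 UV mult.commute)
qed

lemma det_one_minus_X_smult_nonzero: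
  assumes "A \<in> carrier_mat s s"
  shows "det (1\<^sub>m s - [:0, 1:] \<cdot>\<^sub>m const_mat A) \<noteq> 0"
proof -
  have "map_mat (\<lambda>p. poly p 0) (1\<^sub>m s - [:0, 1:] \<cdot>\<^sub>m const_mat A) = 1\<^sub>m s"
    using assms by (intro eq_matI) (auto simp: const_mat_def)
  then have "poly (det (1\<^sub>m s - [:0, 1:] \<cdot>\<^sub>m const_mat A)) 0 = 1"
    by (simp flip: comm_ring_hom.hom_det[OF poly_hom.comm_ring_hom_axioms])
  then show ?thesis
    by auto
qed

text \<open>
  The polynomials \<open>w i / q\<close> are the stage values of the method on the test equation, which
  solve \<open>y = e + z A y\<close>. When \<open>b\<close> is a row of \<open>A\<close>, the corresponding stage value is the
  result \<open>1 + z b\<^sup>T y\<close> of the step.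
\<close>

lemma stability_function_stiffly_accurate:
  fixes w :: "nat \<Rightarrow> real poly"
  assumes A: "A \<in> carrier_mat s s" and k: "k < s" and b: "b = row A k"
    and stages: "\<And>i. i < s \<Longrightarrow> w i = q + [:0, 1:] * (\<Sum>j<s. smult (A $$ (i, j)) (w j))"
    and q: "q \<noteq> 0"
  shows "stability_function A b =
           Fract (map_poly complex_of_real (w k)) (map_poly complex_of_real q)"
proof -
  let ?h = "map_poly complex_of_real"
  let ?M = "1\<^sub>m s - [:0, 1:] \<cdot>\<^sub>m const_mat A :: complex poly mat"
  define w' where "w' = vec s (\<lambda>i. ?h (w i))"
  define u where "u = vec s (\<lambda>_. [:0, 1:] :: complex poly)"
  define v where "v = vec s (\<lambda>j. [:complex_of_real (b $ j):])"
  interpret h: map_poly_inj_idom_hom complex_of_real ..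
  have M: "?M \<in> carrier_mat s s"
    unfolding const_mat_def using A
    by (intro minus_carrier_mat smult_carrier_mat map_carrier_mat[THEN iffD2])
  have stages': "?h (w i) - [:0, 1:] * (\<Sum>j<s. [:complex_of_real (A $$ (i, j)):] * ?h (w j)) = ?h q"
    if "i < s" for i
  proof -
    have "?h (w i) = ?h q + ?h [:0, 1:] * (\<Sum>j<s. ?h (smult (A $$ (i, j)) (w j)))"
      unfolding h.hom_sum[symmetric] h.hom_mult[symmetric] h.hom_add[symmetric]
      by (rule arg_cong[OF stages[OF that]])
    then show ?thesis
      by (simp add: of_real_hom.map_poly_hom_smult)
  qed
  have sol: "?M *\<^sub>v ([:0, 1:] \<cdot>\<^sub>v w') = ?h q \<cdot>\<^sub>v u"
  proof (rule eq_vecI)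
    fix i assume "i < dim_vec (?h q \<cdot>\<^sub>v u)"
    then have i: "i < s" by (simp add: u_def)
    have "(?M *\<^sub>v ([:0, 1:] \<cdot>\<^sub>v w')) $ i
        = (\<Sum>j<s. ((if i = j then 1 else 0) - [:0, 1:] * [:complex_of_real (A $$ (i, j)):])
              * ([:0, 1:] * ?h (w j)))"
      using i A by (auto simp: w'_def scalar_prod_def const_mat_def lessThan_atLeast0 intro!: sum.cong)
    also have "\<dots> = [:0, 1:] * (\<Sum>j<s. (if i = j then ?h (w j) else 0)
              - [:0, 1:] * ([:complex_of_real (A $$ (i, j)):] * ?h (w j)))"
      unfolding sum_distrib_left by (intro sum.cong) (auto simp: algebra_simps)
    also have "\<dots> = [:0, 1:] * ?h q"
      using i stages'[OF i] by (simp add: sum_subtractf sum_distrib_left)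
    finally show "(?M *\<^sub>v ([:0, 1:] \<cdot>\<^sub>v w')) $ i = (?h q \<cdot>\<^sub>v u) $ i"
      using i by (simp add: u_def mult.commute)
  qed (use A in \<open>auto simp: u_def const_mat_def\<close>)
  have "?h q + v \<bullet> ([:0, 1:] \<cdot>\<^sub>v w')
      = ?h q + [:0, 1:] * (\<Sum>j<s. [:complex_of_real (A $$ (k, j)):] * ?h (w j))"
    unfolding sum_distrib_left
    using A k b by (auto simp: v_def w'_def scalar_prod_def lessThan_atLeast0 intro!: sum.cong)
  also have "\<dots> = ?h (w k)"
    using stages'[OF k] by (simp add: algebra_simps)
  finally have num: "?h q + v \<bullet> ([:0, 1:] \<cdot>\<^sub>v w') = ?h (w k)" .
  have rank_one: "[:0, 1:] \<cdot>\<^sub>m const_mat (mat s s (\<lambda>(i, j). vec s (\<lambda>_. 1) $ i * b $ j))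
      = mat s s (\<lambda>(i, j). u $ i * v $ j)"
    by (intro eq_matI) (auto simp: const_mat_def u_def v_def)
  have "det (?M + mat s s (\<lambda>(i, j). u $ i * v $ j)) * ?h q = ?h (w k) * det ?M"
    unfolding num[symmetric] mult.commute[of _ "?h q"]
    by (rule det_rank_one_update_of_solution[OF M _ _ _ sol]) (auto simp: u_def v_def w'_def)
  moreover have "?h q \<noteq> 0"
    using q by simp
  ultimately show ?thesis
    using A det_one_minus_X_smult_nonzero[OF A]
    by (simp add: stability_function_def Let_def rank_one eq_fract)
qed

section \<open>Existence of a maximum angle\<close>

text \<open>
  A coprime numerator and denominator have no common root, so at a pole the inequality on the
  right fails as well. This form of the condition is closed in \<open>z\<close>.
\<close>

lemma norm_le_one_at_iff:
  "norm_le_one_at W z \<longleftrightarrow>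
     norm (poly (fst (quot_of_fract W)) z) \<le> norm (poly (snd (quot_of_fract W)) z)"
proof -
  let ?p = "fst (quot_of_fract W)" and ?q = "snd (quot_of_fract W)"
  have "\<not> (poly ?p z = 0 \<and> poly ?q z = 0)"
  proof
    assume "poly ?p z = 0 \<and> poly ?q z = 0"
    then have "[:- z, 1:] dvd ?p" "[:- z, 1:] dvd ?q"
      by (auto simp: poly_eq_0_iff_dvd)
    then have "is_unit [:- z, 1:]"
      using coprime_quot_of_fract coprime_common_divisor by blast
    then show False
      by (simp add: is_unit_pCons_iff)
  qed
  then show ?thesis
    by (auto simp: norm_le_one_at_def Let_def case_prod_unfold norm_divide divide_le_eq_1)
qed

lemma norm_le_one_at_Fract:
  assumes "poly q z \<noteq> 0" "norm (poly p z) \<le> norm (poly q z)"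
  shows "norm_le_one_at (Fract p q) z"
proof -
  obtain p' q' where pq': "quot_of_fract (Fract p q) = (p', q')"
    by force
  have "q \<noteq> 0" "q' \<noteq> 0"
    using assms(1) snd_quot_of_fract_nonzero[of "Fract p q"] pq' by auto
  moreover have "Fract p' q' = Fract p q"
    using Fract_quot_of_fract[of "Fract p q"] pq' by simp
  ultimately have "p' * q = p * q'"
    by (simp add: eq_fract)
  then have "poly p' z * poly q z = poly p z * poly q' z"
    by (metis poly_mult)
  then have "norm (poly p' z) * norm (poly q z) = norm (poly p z) * norm (poly q' z)"
    by (metis norm_mult)
  also have "\<dots> \<le> norm (poly q' z) * norm (poly q z)"
    using assms(2) by (subst mult.commute) (simp add: mult_left_mono)
  finally have "norm (poly p' z) \<le> norm (poly q' z)"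
    using assms(1) by simp
  then show ?thesis
    by (simp add: norm_le_one_at_iff pq')
qed

lemma Arg_scale_cis:
  assumes "0 < r" "- pi < t" "t \<le> pi"
  shows "Arg (of_real r * cis t) = t"
  using assms by (intro cis_Arg_unique) (auto simp: sgn_mult sgn_of_real)

text \<open>
  Points of the open sector lie in the sector of some angle from \<open>S\<close>. A point on the boundary
  rays of the sector of angle \<open>Sup S\<close> is the limit of points obtained by rotating it towards the
  negative real axis, and the inequality between the norms passes to the limit.
\<close>

lemma A_alpha_stable_Sup:
  assumes S: "S \<noteq> {}" "\<And>\<alpha>. \<alpha> \<in> S \<Longrightarrow> 0 < \<alpha> \<and> \<alpha> \<le> pi / 2 \<and> A_alpha_stable A b \<alpha>"
  shows "A_alpha_stable A b (Sup S)"
  unfolding A_alpha_stable_def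
proof
  fix z assume z: "z \<in> sector (Sup S)"
  obtain p q where pq: "quot_of_fract (stability_function A b) = (p, q)"
    by force
  have bdd: "bdd_above S"
    using S(2) by (intro bdd_aboveI[of _ "pi / 2"]) simp
  obtain \<alpha>0 where \<alpha>0: "\<alpha>0 \<in> S"
    using S(1) by auto
  have inner: "norm (poly p x) \<le> norm (poly q x)" if "x = 0 \<or> \<bar>Arg (- x)\<bar> < Sup S" for x
  proof -
    obtain \<alpha> where "\<alpha> \<in> S" "x \<in> sector \<alpha>"
    proof (cases "x = 0")
      case True
      with \<alpha>0 that show ?thesis
        by (auto simp: sector_def)
    next
      case False
      with \<open>x = 0 \<or> \<bar>Arg (- x)\<bar> < Sup S\<close> obtain \<alpha> where "\<alpha> \<in> S" "\<bar>Arg (- x)\<bar> < \<alpha>"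
        using less_cSup_iff[OF S(1) bdd] by auto
      with that show ?thesis
        by (auto simp: sector_def)
    qed
    then show ?thesis
      using S(2) by (force simp: A_alpha_stable_def norm_le_one_at_iff pq)
  qed
  show "norm_le_one_at (stability_function A b) z"
  proof (cases "z = 0")
    case True
    then show ?thesis
      using inner[of 0] by (simp add: norm_le_one_at_iff pq)
  next
    case False
    define \<theta> where "\<theta> = Arg (- z)"
    define f where "f t = - (of_real (norm z) * cis (t * \<theta>))" for t :: real
    have \<theta>: "\<bar>\<theta>\<bar> \<le> Sup S" "- pi < \<theta>" "\<theta> \<le> pi"
      using z False Arg_bounded[of "- z"] by (auto simp: sector_def \<theta>_def)
    have "0 < Sup S"
      using S(2)[OF \<alpha>0] cSup_upper[OF \<alpha>0 bdd] by linarith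
    have f1: "f 1 = z"
      using rcis_cmod_Arg[of "- z"] by (simp add: f_def \<theta>_def rcis_def)
    have "norm (poly p (f t)) \<le> norm (poly q (f t))" if t: "t \<in> {0<..<1}" for t
    proof (rule inner, rule disjI2)
      have bound: "\<bar>t * \<theta>\<bar> \<le> \<bar>\<theta>\<bar>" "\<theta> \<noteq> 0 \<Longrightarrow> \<bar>t * \<theta>\<bar> < \<bar>\<theta>\<bar>"
        using t by (auto simp: abs_mult mult_le_cancel_right2)
      have "Arg (- f t) = t * \<theta>"
        unfolding f_def minus_minus
      proof (rule Arg_scale_cis)
        show "- pi < t * \<theta>" "t * \<theta> \<le> pi"
          using bound \<theta> by (cases "\<theta> = 0"; fastforce simp: abs_if split: if_splits)+
      qed (use False in auto)
      then show "\<bar>Arg (- f t)\<bar> < Sup S"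
        using bound \<theta>(1) \<open>0 < Sup S\<close> by (cases "\<theta> = 0") auto
    qed
    then have ev: "eventually (\<lambda>t. norm (poly p (f t)) \<le> norm (poly q (f t))) (at_left 1)"
      using eventually_at_left_real[of 0 1] by (auto elim: eventually_mono)
    have lim: "((\<lambda>t. norm (poly r (f t))) \<longlongrightarrow> norm (poly r (f 1))) (at_left 1)" for r
      unfolding f_def by (intro tendsto_intros) 
    have "norm (poly p (f 1)) \<le> norm (poly q (f 1))"
      by (rule tendsto_le[OF _ lim lim ev]) simp
    then show ?thesis
      by (simp add: norm_le_one_at_iff pq f1)
  qed
qed

lemma maximum_angle_exists:
  assumes "0 < \<alpha>0" "\<alpha>0 \<le> pi / 2" "A_alpha_stable A b \<alpha>0"
  shows "\<exists>\<alpha>. is_maximum_angle A b \<alpha> \<and> \<alpha>0 \<le> \<alpha>"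
proof -
  define S where "S = {\<alpha> \<in> {0<..pi / 2}. A_alpha_stable A b \<alpha>}"
  have \<alpha>0: "\<alpha>0 \<in> S"
    using assms by (simp add: S_def)
  have bdd: "bdd_above S"
    unfolding S_def by (intro bdd_aboveI[of _ "pi / 2"]) simp
  have "Sup S \<le> pi / 2"
    using \<alpha>0 by (intro cSup_least) (auto simp: S_def)
  moreover have "\<alpha>0 \<le> Sup S"
    by (rule cSup_upper[OF \<alpha>0 bdd])
  moreover have "A_alpha_stable A b (Sup S)"
    using \<alpha>0 by (intro A_alpha_stable_Sup) (auto simp: S_def)
  moreover have "\<alpha> \<le> Sup S" if "\<alpha> \<in> {0<..pi / 2}" "A_alpha_stable A b \<alpha>" for \<alpha>
    using that by (intro cSup_upper[OF _ bdd]) (simp add: S_def)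
  ultimately show ?thesis
    using assms(1) unfolding is_maximum_angle_def by (intro exI[of _ "Sup S"]) auto
qed

lemma sector_arccos_bound:
  assumes z: "z \<in> sector (arccos \<beta>)" and \<beta>: "0 \<le> \<beta>" "\<beta> \<le> 1"
  shows "\<beta> * norm z \<le> - Re z"
proof (cases "z = 0")
  case False
  have "\<bar>Arg (- z)\<bar> \<le> arccos \<beta>"
    using z False by (simp add: sector_def)
  then have "cos (arccos \<beta>) \<le> cos \<bar>Arg (- z)\<bar>"
    using \<beta> arccos_lbound[of \<beta>] arccos_ubound[of \<beta>]
    by (intro cos_monotone_0_pi_le) auto
  then have "\<beta> \<le> - Re z / norm z"
    using \<beta> False cos_Arg[of "- z"] by simp
  then show ?thesis
    using False by (metis pos_le_divide_eq zero_less_norm_iff)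
qed auto

section \<open>Squared norms of real polynomials in polar coordinates\<close>

text \<open>
  The remainder \<open>\<alpha> + \<beta> z\<close> of the polynomial with coefficient list \<open>as\<close> on division by
  \<open>z\<^sup>2 + s z + R\<close>, computed by Horner's scheme. It is defined over any commutative ring so
  that \<open>s\<close> and \<open>R\<close> can be polynomials themselves.
\<close>

fun quadratic_remainder :: "'a :: comm_ring_1 \<Rightarrow> 'a \<Rightarrow> 'a list \<Rightarrow> 'a \<times> 'a" where
  "quadratic_remainder s R [] = (0, 0)"
| "quadratic_remainder s R (a # as) =
     (case quadratic_remainder s R as of (\<alpha>, \<beta>) \<Rightarrow> (a - R * \<beta>, \<alpha> - s * \<beta>))"

text \<open>
  The product of the values of the polynomial at the two roots of \<open>z\<^sup>2 + s z + R\<close>.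
\<close>

definition root_value_product :: "'a :: comm_ring_1 \<Rightarrow> 'a \<Rightarrow> 'a list \<Rightarrow> 'a" where
  "root_value_product s R as =
     (case quadratic_remainder s R as of (\<alpha>, \<beta>) \<Rightarrow> \<alpha> * \<alpha> - s * \<alpha> * \<beta> + R * \<beta> * \<beta>)"

lemma poly_eq_quadratic_remainder:
  assumes "quadratic_remainder (- 2 * Re z) ((norm z)\<^sup>2) as = (\<alpha>, \<beta>)"
  shows "poly (map_poly complex_of_real (Poly as)) z = of_real \<alpha> + of_real \<beta> * z"
  using assms
proof (induction as arbitrary: \<alpha> \<beta>)
  case (Cons a as)
  obtain \<alpha>' \<beta>' where rest: "quadratic_remainder (- 2 * Re z) ((norm z)\<^sup>2) as = (\<alpha>', \<beta>')"
    by force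
  have square: "z * z = of_real (2 * Re z) * z - of_real ((norm z)\<^sup>2)"
    by (simp add: complex_eq_iff cmod_power2) (simp add: power2_eq_square algebra_simps)
  have "poly (map_poly complex_of_real (Poly (a # as))) z
      = of_real a + z * (of_real \<alpha>' + of_real \<beta>' * z)"
    using Cons.IH[OF rest] by (simp add: of_real_hom.map_poly_pCons_hom)
  also have "\<dots> = of_real a + of_real \<alpha>' * z + of_real \<beta>' * (z * z)"
    by (simp add: algebra_simps)
  also have "\<dots> = of_real \<alpha> + of_real \<beta> * z"
    using Cons.prems rest unfolding square by (auto simp: algebra_simps)
  finally show ?case .
qed simp

text \<open>
  The quadratic with roots \<open>z\<close> and its conjugate is \<open>z\<^sup>2 - 2 Re(z) z + \<bar>z\<bar>\<^sup>2\<close>, and a real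
  polynomial takes conjugate values at these two points.
\<close>

lemma norm_poly_eq_root_value_product:
  "(norm (poly (map_poly complex_of_real (Poly as)) z))\<^sup>2
     = root_value_product (- 2 * Re z) ((norm z)\<^sup>2) as"
proof -
  obtain \<alpha> \<beta> where rem: "quadratic_remainder (- 2 * Re z) ((norm z)\<^sup>2) as = (\<alpha>, \<beta>)"
    by force
  show ?thesis
    unfolding poly_eq_quadratic_remainder[OF rem] root_value_product_def rem
    by (simp add: cmod_power2) (simp add: power2_eq_square algebra_simps)
qed

lemma (in comm_ring_hom) hom_quadratic_remainder:
  "quadratic_remainder (hom s) (hom R) (map hom as) = map_prod hom hom (quadratic_remainder s R as)"
  by (induction as) (auto simp: hom_distribs split: prod.splits)

lemma (in comm_ring_hom) hom_root_value_product:
  "root_value_product (hom s) (hom R) (map hom as) = hom (root_value_product s R as)"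
  by (auto simp: root_value_product_def hom_quadratic_remainder hom_distribs split: prod.splits)

text \<open>
  The squared norm at a point with \<open>Re z = - c r\<close> and \<open>\<bar>z\<bar> = r\<close>, as a polynomial in \<open>c\<close> (outer
  variable) with coefficients in \<open>\<real>[r]\<close>; here \<open>s = 2 c r\<close> and \<open>R = r\<^sup>2\<close>. As an element of a
  polynomial ring it has a normal form that can be computed by rewriting.
\<close>

definition polar_norm_square :: "real list \<Rightarrow> real poly poly" where
  "polar_norm_square as =
     root_value_product [:0, [:0, 2:]:] [:[:0, 0, 1:]:] (map (\<lambda>a. [:[:a:]:]) as)"

lemma poly_polar_norm_square:
  assumes "Re z = - (c * r)" "norm z = r"
  shows "poly (poly (polar_norm_square as) [:c:]) r
           = (norm (poly (map_poly complex_of_real (Poly as)) z))\<^sup>2"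
proof -
  interpret ev: comm_ring_hom "\<lambda>p. poly (poly p [:c:]) r"
    by unfold_locales auto
  have "- 2 * Re z = poly (poly [:0, [:0, 2:]:] [:c:]) r"
    "(norm z)\<^sup>2 = poly (poly [:[:0, 0, 1:]:] [:c:]) r"
    "as = map (\<lambda>p. poly (poly p [:c:]) r) (map (\<lambda>a. [:[:a:]:]) as)"
    using assms by (simp_all add: power2_eq_square comp_def)
  then have "(norm (poly (map_poly complex_of_real (Poly as)) z))\<^sup>2
      = root_value_product (poly (poly [:0, [:0, 2:]:] [:c:]) r)
          (poly (poly [:[:0, 0, 1:]:] [:c:]) r)
          (map (\<lambda>p. poly (poly p [:c:]) r) (map (\<lambda>a. [:[:a:]:]) as))"
    unfolding norm_poly_eq_root_value_product by metis
  also have "\<dots> = poly (poly (polar_norm_square as) [:c:]) r"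
    unfolding polar_norm_square_def by (rule ev.hom_root_value_product)
  finally show ?thesis ..
qed

section \<open>Stability from a coefficient certificate\<close>

lemma poly_nonneg_of_coeffs:
  fixes p :: "real poly"
  assumes "\<forall>a\<in>set (coeffs p). 0 \<le> a" "0 \<le> r"
  shows "0 \<le> poly p r"
  using assms by (induction p) (auto simp: cCons_def split: if_splits)

lemma poly_pos_of_coeffs:
  fixes p :: "real poly"
  assumes "\<forall>a\<in>set (coeffs p). 0 \<le> a" "0 < coeff p k" "0 < r"
  shows "0 < poly p r"
proof -
  have nonneg: "0 \<le> coeff p i" for i
    using assms(1) coeff_in_coeffs[of p i] by (cases "i \<le> degree p \<and> p \<noteq> 0") (auto simp: coeff_eq_0)
  have "0 < coeff p k * r ^ k"
    using assms by simp
  also have "\<dots> \<le> (\<Sum>i\<le>degree p. coeff p i * r ^ i)"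
  proof (rule member_le_sum)
    show "k \<in> {..degree p}"
      using assms(2) le_degree[of p k] by simp
    show "0 \<le> coeff p i * r ^ i" for i
      using nonneg[of i] assms(3) by simp
  qed simp
  finally show ?thesis
    by (simp add: poly_altdef)
qed

lemma poly_mono_in_outer_variable:
  fixes D :: "real poly poly"
  assumes "\<forall>E\<in>set (coeffs D). \<forall>a\<in>set (coeffs E). 0 \<le> a" "0 \<le> \<beta>" "\<beta> \<le> c" "0 \<le> r"
  shows "0 \<le> poly (poly D [:\<beta>:]) r \<and> poly (poly D [:\<beta>:]) r \<le> poly (poly D [:c:]) r"
  using assms(1)
proof (induction D)
  case (pCons E D)
  have "0 \<le> poly E r"
    using pCons.prems assms(4)
    by (cases "E = 0") (auto intro!: poly_nonneg_of_coeffs simp: cCons_def split: if_splits)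
  moreover have "0 \<le> poly (poly D [:\<beta>:]) r \<and> poly (poly D [:\<beta>:]) r \<le> poly (poly D [:c:]) r"
    using pCons by (auto simp: cCons_def split: if_splits)
  ultimately show ?case
    using assms by (auto intro!: mult_mono)
qed simp

text \<open>
  A polynomial in \<open>r\<close> with a near-double root \<open>m > 0\<close> has coefficients of both signs, so these
  alone do not show that it is positive. By the rule of signs, division by \<open>(r - m)\<^sup>2\<close> can remove
  the two sign changes; then it is enough to look at the coefficients of the quotient \<open>Q\<close> and of
  the remainder. The factor \<open>r\<close> accounts for the root at 0.
\<close>

definition positivity_certificate :: "real \<Rightarrow> real poly \<Rightarrow> real poly \<Rightarrow> bool" where
  "positivity_certificate m Q G \<longleftrightarrow>
     (let P = G - [:0, 1:] * ([:- m, 1:]\<^sup>2 * Q)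
      in (\<forall>a\<in>set (coeffs Q). 0 \<le> a) \<and> (\<forall>a\<in>set (coeffs P). 0 \<le> a) \<and> 0 < coeff P 1)"

lemma poly_pos_of_certificate:
  assumes "positivity_certificate m Q G" "0 < r"
  shows "0 < poly G r"
proof -
  define P where "P = G - [:0, 1:] * ([:- m, 1:]\<^sup>2 * Q)"
  have cert: "\<forall>a\<in>set (coeffs Q). 0 \<le> a" "\<forall>a\<in>set (coeffs P). 0 \<le> a" "0 < coeff P 1"
    using assms(1) by (auto simp: positivity_certificate_def Let_def P_def)
  have "0 \<le> r * ((r - m)\<^sup>2 * poly Q r)"
    using assms(2) cert(1) by (intro mult_nonneg_nonneg poly_nonneg_of_coeffs) auto
  then have "0 < poly P r + r * ((r - m)\<^sup>2 * poly Q r)"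
    using poly_pos_of_coeffs[OF cert(2,3) assms(2)] by linarith
  also have "\<dots> = poly G r"
    by (simp add: P_def power2_eq_square algebra_simps)
  finally show ?thesis .
qed

text \<open>
  In \<open>\<bar>q\<bar>\<^sup>2 - \<bar>p\<bar>\<^sup>2\<close> the coefficient of \<open>c\<^sup>0\<close> is the only one whose sign is not controlled, whence
  \<open>tl\<close>. Monotonicity in \<open>c\<close> reduces the sector to the boundary rays \<open>c = \<beta>\<close>. There the
  inequality is strict for \<open>r > 0\<close>, which also excludes zeros of the denominator.
\<close>

lemma A_alpha_stable_of_certificate:
  fixes as bs :: "real list" and D :: "real poly poly"
  assumes W: "stability_function A b =
      Fract (map_poly complex_of_real (Poly bs)) (map_poly complex_of_real (Poly as))"
    and at_0: "coeff (Poly bs) 0 = coeff (Poly as) 0" "coeff (Poly as) 0 \<noteq> 0"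
    and gap: "polar_norm_square as - polar_norm_square bs = D"
    and mono: "\<forall>E\<in>set (tl (coeffs D)). \<forall>a\<in>set (coeffs E). 0 \<le> a"
    and cert: "positivity_certificate m Q (poly D [:\<beta>:])"
    and \<beta>: "0 \<le> \<beta>" "\<beta> \<le> 1"
  shows "A_alpha_stable A b (arccos \<beta>)"
  unfolding A_alpha_stable_def
proof
  fix z assume z: "z \<in> sector (arccos \<beta>)"
  let ?p = "map_poly complex_of_real (Poly bs)" and ?q = "map_poly complex_of_real (Poly as)"
  have "poly ?q z \<noteq> 0 \<and> norm (poly ?p z) \<le> norm (poly ?q z)"
  proof (cases "z = 0")
    case True
    then show ?thesis
      using at_0 by (simp add: poly_0_coeff_0)
  next
    case False
    define r where "r = norm z"
    define c where "c = - Re z / r"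
    have r: "0 < r"
      using False by (simp add: r_def)
    have Re: "Re z = - (c * r)"
      using r by (simp add: c_def)
    have c: "\<beta> \<le> c"
      using sector_arccos_bound[OF z \<beta>] r unfolding c_def r_def by (subst pos_le_divide_eq)
    obtain E D' where D: "D = pCons E D'"
      by (rule pCons_cases)
    have D': "\<forall>F\<in>set (coeffs D'). \<forall>a\<in>set (coeffs F). 0 \<le> a"
      using mono by (auto simp: D cCons_def split: if_splits)
    have "0 < poly (poly D [:\<beta>:]) r"
      by (rule poly_pos_of_certificate[OF cert r])
    also have "\<dots> \<le> poly (poly D [:c:]) r"
    proof -
      have "\<beta> * poly (poly D' [:\<beta>:]) r \<le> c * poly (poly D' [:c:]) r"
        using poly_mono_in_outer_variable[OF D' \<beta>(1) c, of r] r \<beta>(1) c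
        by (intro mult_mono) linarith+
      then show ?thesis
        by (simp add: D)
    qed
    also have "\<dots> = (norm (poly ?q z))\<^sup>2 - (norm (poly ?p z))\<^sup>2"
      unfolding gap[symmetric] using poly_polar_norm_square[OF Re] by (simp add: r_def)
    finally have "(norm (poly ?p z))\<^sup>2 < (norm (poly ?q z))\<^sup>2"
      by simp
    then have "norm (poly ?p z) < norm (poly ?q z)"
      by (rule power2_less_imp_less) simp
    then show ?thesis
      by auto
  qed
  then show "norm_le_one_at (stability_function A b) z"
    unfolding W by (intro norm_le_one_at_Fract) auto
qed

lemma maximum_angle_ge_arccos:
  assumes "A_alpha_stable A b (arccos \<beta>)" "0 \<le> \<beta>" "\<beta> < 1"
  shows "\<exists>\<alpha>. is_maximum_angle A b \<alpha> \<and> arccos \<beta> \<le> \<alpha>"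
proof (rule maximum_angle_exists)
  show "0 < arccos \<beta>"
    using assms arccos_less_arccos[of \<beta> 1] by simp
  show "arccos \<beta> \<le> pi / 2"
    using assms arccos_le_pi2 by simp
qed (rule assms)

section \<open>The Ramos--Vigo scheme\<close>

text \<open>
  The solution \<open>w\<close> of \<open>(I - z A) w = q e\<close> given by Cramer's rule, with \<open>q = 384 det (I - z A)\<close>.
\<close>

definition ramos_vigo_stages :: "real poly list" where
  "ramos_vigo_stages =
    [[:384, - 48 - 96 * sqrt 2, 20 + 12 * sqrt 2, - 2 - sqrt 2:],
     [:384, - 48, - 4, 1:],
     [:384, - 48 + 96 * sqrt 2, 20 - 12 * sqrt 2, - 2 + sqrt 2:],
     [:384, 144, 20, 1:]]"

lemma ramos_vigo_stages_solve:
  assumes "i < 4"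
  shows "ramos_vigo_stages ! i = Poly [384, - 240, 68, - 11, 1]
    + [:0, 1:] * (\<Sum>j<4. smult (ramos_vigo_A $$ (i, j)) (ramos_vigo_stages ! j))"
proof -
  have "i = 0 \<or> i = 1 \<or> i = 2 \<or> i = 3"
    using assms by auto
  then show ?thesis
    by (elim disjE)
       (simp_all add: ramos_vigo_stages_def ramos_vigo_A_def mat_of_rows_list_def eval_nat_numeral,
        simp_all add: algebra_simps add_divide_distrib diff_divide_distrib)
qed

lemma stability_function_ramos_vigo:
  "stability_function ramos_vigo_A ramos_vigo_b =
     Fract (map_poly complex_of_real (Poly [384, 144, 20, 1]))
       (map_poly complex_of_real (Poly [384, - 240, 68, - 11, 1]))"
proof -
  have "ramos_vigo_b = row ramos_vigo_A 3"
    by (intro eq_vecI)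
       (auto simp: ramos_vigo_b_def ramos_vigo_A_def mat_of_rows_list_def vec_of_list_index
         less_Suc_eq numeral_eq_Suc)
  then have "stability_function ramos_vigo_A ramos_vigo_b =
      Fract (map_poly complex_of_real (ramos_vigo_stages ! 3))
        (map_poly complex_of_real (Poly [384, - 240, 68, - 11, 1]))"
    by (intro stability_function_stiffly_accurate[where s = 4] ramos_vigo_stages_solve)
       (auto simp: ramos_vigo_A_def mat_of_rows_list_def)
  then show ?thesis
    by (simp add: ramos_vigo_stages_def)
qed

text \<open>
  The polynomial \<open>\<bar>q\<bar>\<^sup>2 - \<bar>p\<bar>\<^sup>2\<close> in \<open>c\<close> with coefficients in \<open>\<real>[r]\<close>. Its value \<open>r\<^sup>8 - 16 r\<^sup>6\<close> on the
  imaginary axis \<open>c = 0\<close> is negative for \<open>0 < r < 4\<close>, which prevents stability on the whole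
  half-plane; everything else has a positive sign.
\<close>

definition ramos_vigo_gap :: "real poly poly" where
  "ramos_vigo_gap =
     [:[:0, 0, 0, 0, 0, 0, - 16, 0, 1:],
      [:0, 294912, 0, 10752, 0, 96, 0, 22:],
      [:0, 0, 73728, 0, 3840, 0, 272:],
      [:0, 0, 0, 36864, 0, 1920:],
      [:0, 0, 0, 0, 6144:]:]"

lemma ramos_vigo_norm_gap:
  "polar_norm_square [384, - 240, 68, - 11, 1] - polar_norm_square [384, 144, 20, 1] = ramos_vigo_gap"
  by (simp add: polar_norm_square_def root_value_product_def ramos_vigo_gap_def)

text \<open>
  The constant \<open>m\<close> approximates from above the point where the polynomial on the ray \<open>c = \<beta>\<^sup>*\<close>,
  divided by \<open>r\<close>, has its positive local minimum, about \<open>10\<^bsup>-10\<^esup>\<close> times the size of its terms.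
  The coefficients of \<open>Q\<close> are those of the quotient by \<open>(r - m)\<^sup>2\<close>, computed from the leading one
  downwards and each rounded down, so that the remainders stay nonnegative.
\<close>

lemma ramos_vigo_certificate:
  "positivity_certificate (3268969252999 / 1000000000000)
     [:608623148333 / 5000000000, 1865175308543 / 25000000000, 4836611773049 / 125000000000,
          16698183223509 / 1000000000000, 33174869719237 / 5000000000000, 1:]
     (poly ramos_vigo_gap [:19699132 / 4466212691:])"
  by (simp add: positivity_certificate_def Let_def ramos_vigo_gap_def power2_eq_square)

lemma ramos_vigo_stable:
  "A_alpha_stable ramos_vigo_A ramos_vigo_b (arccos (19699132 / 4466212691))"
proof (rule A_alpha_stable_of_certificate[OF stability_function_ramos_vigo _ _ ramos_vigo_norm_gap
      _ ramos_vigo_certificate])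
  show "\<forall>E\<in>set (tl (coeffs ramos_vigo_gap)). \<forall>a\<in>set (coeffs E). 0 \<le> a"
    by (simp add: ramos_vigo_gap_def)
qed simp_all

section \<open>The Skvortsov scheme\<close>

text \<open>
  Forward substitution in the lower triangular system \<open>y = e + z A y\<close> divides by \<open>1 - z / 6\<close> in
  every stage after the first, so the \<open>i\<close>-th stage value has the denominator
  \<open>(6 - z)\<^bsup>i - 1\<^esup>\<close>. The entries below are the numerators over the common
  denominator \<open>(6 - z)\<^sup>8\<close>.
\<close>

definition skvortsov_stages :: "real poly list" where
  "skvortsov_stages =
    [[:6, - 1:] ^ 8 * [:1:],
     [:6, - 1:] ^ 7 * [:6, 1:],
     [:6, - 1:] ^ 6 * [:36, - 3, - 7 / 8:],
     [:6, - 1:] ^ 5 * [:216, 0, - 9, - 5 / 8:],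
     [:6, - 1:] ^ 4 * [:1296, 108, - 135 / 2, - 111 / 8, 451 / 2512:],
     [:6, - 1:] ^ 3 * [:7776, 1296, - 432, - 144, 20238 / 4553, - 8111 / 4553:],
     [:6, - 1:] ^ 2 * [:46656, - 23328, 1944, 540, 304452 / 4553, - 238665 / 5024, 35961 / 36424:],
     [:6, - 1:] * [:279936, - 256608, 90396, - 14013, 1594782 / 4553, 128785869 / 582784,
        - 35700063 / 1165568, 94165 / 291392:],
     [:1679616, - 559872, - 93312, 31104, 5184, - 3456 / 5, - 1008 / 5, 10773 / 785:]]"

lemma skvortsov_stages_solve:
  assumes "i < 9"
  shows "skvortsov_stages ! i =
    Poly [1679616, - 2239488, 1306368, - 435456, 90720, - 12096, 1008, - 48, 1]
    + [:0, 1:] * (\<Sum>j<9. smult (skvortsov_A $$ (i, j)) (skvortsov_stages ! j))"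
proof -
  have "i = 0 \<or> i = 1 \<or> i = 2 \<or> i = 3 \<or> i = 4 \<or> i = 5 \<or> i = 6 \<or> i = 7 \<or> i = 8"
    using assms by auto
  then show ?thesis
    by (elim disjE)
       (simp_all add: skvortsov_stages_def skvortsov_A_def mat_of_rows_list_def eval_nat_numeral)
qed

lemma stability_function_skvortsov:
  "stability_function skvortsov_A skvortsov_b =
     Fract (map_poly complex_of_real
         (Poly [1679616, - 559872, - 93312, 31104, 5184, - 3456 / 5, - 1008 / 5, 10773 / 785]))
       (map_poly complex_of_real
         (Poly [1679616, - 2239488, 1306368, - 435456, 90720, - 12096, 1008, - 48, 1]))"
proof -
  have "stability_function skvortsov_A skvortsov_b =
      Fract (map_poly complex_of_real (skvortsov_stages ! 8))
        (map_poly complex_of_real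
          (Poly [1679616, - 2239488, 1306368, - 435456, 90720, - 12096, 1008, - 48, 1]))"
    by (intro stability_function_stiffly_accurate[where s = 9] skvortsov_stages_solve)
       (auto simp: skvortsov_A_def skvortsov_b_def mat_of_rows_list_def)
  then show ?thesis
    by (simp add: skvortsov_stages_def)
qed

text \<open>
  Again \<open>\<bar>q\<bar>\<^sup>2 - \<bar>p\<bar>\<^sup>2\<close> as a polynomial in \<open>c\<close> with coefficients in \<open>\<real>[r]\<close>. The three negative
  coefficients all belong to \<open>c = 0\<close>.
\<close>

definition skvortsov_gap :: "real poly poly" where
  "skvortsov_gap =
     [:[:0, 0, 0, 0, 0, 0, 0, 0, - 4152010752 / 785, 0, - 3175034112 / 3925, 0, - 91554624 / 3925, 0,
       61415271 / 616225, 0, 1:],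
      [:0, 5642219814912, 0, 1253826625536, 0, 121899810816, 0, 5012232804864 / 785, 0,
       136916137728 / 785, 0, 9673437312 / 3925, 0, 73235232 / 3925, 0, 96:],
      [:0, 0, 9403699691520, 0, 1671768834048, 0, 121899810816, 0, 694870576128 / 157, 0,
       70172863488 / 785, 0, 3567255552 / 3925, 0, 4032:],
      [:0, 0, 0, 6269133127680, 0, 835884417024, 0, 34328744275968 / 785, 0, 985309774848 / 785, 0,
       14120096256 / 785, 0, 96768:],
      [:0, 0, 0, 0, 2298682146816, 0, 232190115840, 0, 8045011279872 / 785, 0, 158718486528 / 785, 0,
       1451520:],
      [:0, 0, 0, 0, 0, 3064909529088 / 5, 0, 41311620145152 / 785, 0, 1149206704128 / 785, 0, 13934592:],
      [:0, 0, 0, 0, 0, 0, 650132324352 / 5, 0, 5111514906624 / 785, 0, 83607552:],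
      [:0, 0, 0, 0, 0, 0, 0, 10416951558144 / 785, 0, 286654464:],
      [:0, 0, 0, 0, 0, 0, 0, 0, 429981696:]:]"

lemma skvortsov_norm_gap:
  "polar_norm_square [1679616, - 2239488, 1306368, - 435456, 90720, - 12096, 1008, - 48, 1]
   - polar_norm_square [1679616, - 559872, - 93312, 31104, 5184, - 3456 / 5, - 1008 / 5, 10773 / 785] = skvortsov_gap"
  by (simp add: polar_norm_square_def root_value_product_def skvortsov_gap_def)

text \<open>
  The constants arise as for the other scheme. Here the local minimum is near
  \<open>r = 8.03\<close> and has the relative size \<open>10\<^bsup>-8\<^esup>\<close>.
\<close>

lemma skvortsov_certificate:
  "positivity_certificate (200795593 / 25000000)
     [:1940252000, 554881700, 540339670, 138711133, 136453177 / 2, 1576971627 / 100, 2536188391 / 500,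
          9704315559 / 10000, 22321069039 / 100000, 28681743709 / 1000000, 9065079127 / 2000000,
          4117374633 / 12500000, 18193380747 / 1000000000, 1:]
     (poly skvortsov_gap [:2218472195 / 100000000000:])"
  by (simp add: positivity_certificate_def Let_def skvortsov_gap_def power2_eq_square)

lemma skvortsov_stable:
  "A_alpha_stable skvortsov_A skvortsov_b (arccos (2218472195 / 100000000000))"
proof (rule A_alpha_stable_of_certificate[OF stability_function_skvortsov _ _ skvortsov_norm_gap
      _ skvortsov_certificate])
  show "\<forall>E\<in>set (tl (coeffs skvortsov_gap)). \<forall>a\<in>set (coeffs E). 0 \<le> a"
    by (simp add: skvortsov_gap_def)
qed simp_all

theorem lemma5p6:
  shows "(\<exists>\<alpha>. is_maximum_angle ramos_vigo_A ramos_vigo_b \<alpha> \<and>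
              \<alpha> \<ge> arccos (19699132 / 4466212691)) \<and>
         (\<exists>\<alpha>. is_maximum_angle skvortsov_A skvortsov_b \<alpha> \<and>
              \<alpha> \<ge> arccos (2218472195 / 100000000000))"
  using maximum_angle_ge_arccos[OF ramos_vigo_stable] maximum_angle_ge_arccos[OF skvortsov_stable]
  by simp

end
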